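(* Let $\vec{w}$ be a finite sequence $(w_i; i\in n)$ or an infinite sequence $(w_i;i\in\omega)$ of real numbers with $\frac13<w_i<1$ for all indices $i$. Then the Cantor type set $[0(\vec{w})1]$ satisfies the 4-values condition.
   Context: For reals $a\le b$ and a number $0<w<1$ put $\gamma(a,w,b)=\frac12\big((1+w)a+(1-w)b\big)$ and $\delta(a,w,b)=\frac12\big((1-w)a+(1+w)b\big)$, so that $[a,\gamma(a,w,b)]\cup[\delta(a,w,b),b]$ is obtained from $[a,b]$ by removing the middle open interval of length $w(b-a)$. For a finite sequence $\vec w=(w_0,\dots,w_{n-1})$ the set $[a(\vec w)b]$ is defined recursively: if $\vec w$ is empty, $[a(\vec w)b]=[a,b]$; otherwise, with $\vec w_\ast=(w_1,\dots,w_{n-1})$, $[a(\vec w)b]=[a(\vec w_\ast)\gamma(a,w_0,b)]\cup[\delta(a,w_0,b)(\vec w_\ast)b]$. For an infinite sequence $\vec w=(w_i;i\in\omega)$, $[0(\vec w)1]=\bigcap_{n\in\omega}[0(\vec W_n)1]$ where $\vec W_n=(w_i;i\in n)$ is the sequence of the first $n$ entries. A triple $(a,b,c)$ of nonnegative reals is metric if each entry is at most the sum of the other two. For $\mathcal R\subseteq\mathbb{R}_{\ge0}$ let $\mathscr Q(\mathcal R)$ be the set of quadruples $(a,b,c,d)$ with entries in $\mathcal R$ and $\max\{b,c,d\}\le a\le b+c+d$. Write $x\leadsto(a,b,c,d)$ if the triples $(a,b,x)$ and $(c,d,x)$ are metric. $\mathcal R$ satisfies the 4-values condition if for all $(a,b,c,d)\in\mathscr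 Q(\mathcal R)$ and all $x\in\mathcal R$ with $x\leadsto(a,b,c,d)$ there exists $y\in\mathcal R$ with $y\leadsto(a,d,c,b)$. *)

theory Defs
  imports Complex_Main
begin

definition gap_left :: "real \<Rightarrow> real \<Rightarrow> real \<Rightarrow> real" where
  "gap_left a w b = 1/2 * ((1 + w) * a + (1 - w) * b)"

definition gap_right :: "real \<Rightarrow> real \<Rightarrow> real \<Rightarrow> real" where
  "gap_right a w b = 1/2 * ((1 - w) * a + (1 + w) * b)"

fun cantor_fin :: "real \<Rightarrow> real list \<Rightarrow> real \<Rightarrow> real set" where
  "cantor_fin a [] b = {a..b}"
| "cantor_fin a (w # ws) b =
     cantor_fin a ws (gap_left a w b) \<union> cantor_fin (gap_right a w b) ws b"

definition cantor_inf :: "real \<Rightarrow> (nat \<Rightarrow> real) \<Rightarrow> real \<Rightarrow> real set" where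
  "cantor_inf a w b = (\<Inter>n. cantor_fin a (map w [0..<n]) b)"

definition metric_triple :: "real \<Rightarrow> real \<Rightarrow> real \<Rightarrow> bool" where
  "metric_triple a b c \<longleftrightarrow>
     0 \<le> a \<and> 0 \<le> b \<and> 0 \<le> c \<and> a \<le> b + c \<and> b \<le> a + c \<and> c \<le> a + b"

definition quadruples :: "real set \<Rightarrow> (real \<times> real \<times> real \<times> real) set" where
  "quadruples R = {(a, b, c, d). a \<in> R \<and> b \<in> R \<and> c \<in> R \<and> d \<in> R \<and>
     Max {b, c, d} \<le> a \<and> a \<le> b + c + d}"

definition leads_to :: "real \<Rightarrow> real \<times> real \<times> real \<times> real \<Rightarrow> bool" (infix "\<leadsto>" 50) where
  "x \<leadsto> q \<longleftrightarrow> (case q of (a, b, c, d) \<Rightarrow> metric_triple a b x \<and> metric_triple c d x)"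

text \<open>The condition is meant for sets \<open>R\<close> of nonnegative reals.\<close>

definition four_values_condition :: "real set \<Rightarrow> bool" where
  "four_values_condition R \<longleftrightarrow>
     (\<forall>(a, b, c, d) \<in> quadruples R. \<forall>x \<in> R.
        x \<leadsto> (a, b, c, d) \<longrightarrow> (\<exists>y \<in> R. y \<leadsto> (a, d, c, b)))"

end

theory Submission
  imports Defs
begin

text \<open>
  For a set \<open>R\<close> of nonnegative reals the 4-values condition follows from the symmetric property
  \<open>rebracketable\<close> below, which drops all but one bound on each side: in the remaining
  cases \<open>y = a\<close> or \<open>y = max b c\<close> is already a witness. Since \<open>w > 1/3\<close>, a Cantor type set has the
  form \<open>S \<union> (e + S)\<close> with \<open>S \<subseteq> [0, l]\<close> and \<open>2 * l < e\<close>, so sums of two elements of \<open>S\<close> never reach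
  \<open>e + S\<close>. Hence either a trivial witness exists or exactly one of \<open>b, c, d\<close> lies in \<open>e + S\<close>
  whenever \<open>a\<close> does, and subtracting \<open>e\<close> reduces the property to \<open>S\<close>. The infinite case follows
  from the finite one by compactness.
\<close>

section \<open>Reduction to a rebracketing property\<close>

text \<open>In \<open>a \<le> b + (c + d)\<close> the inner sum is bounded below by an element
  \<open>x\<close>; the property passes to the bracketing \<open>(b + c) + d\<close>. Exchanging
  \<open>b\<close> and \<open>d\<close> turns the hypotheses on \<open>x\<close> into the conclusion
  on \<open>y\<close>.\<close>

definition rebracketable :: "real set \<Rightarrow> bool" where
  "rebracketable R \<longleftrightarrow>
     (\<forall>a\<in>R. \<forall>b\<in>R. \<forall>c\<in>R. \<forall>d\<in>R. \<forall>x\<in>R. a \<le> x + b \<longrightarrow> x \<le> c + d \<longrightarrow>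
        (\<exists>y\<in>R. a \<le> y + d \<and> y \<le> b + c))"

lemma rebracketableD:
  assumes "rebracketable R" "a \<in> R" "b \<in> R" "c \<in> R" "d \<in> R" "x \<in> R" "a \<le> x + b" "x \<le> c + d"
  obtains y where "y \<in> R" "a \<le> y + d" "y \<le> b + c"
  using assms unfolding rebracketable_def by blast

lemma rebracketable_imp_four_values_condition:
  assumes "rebracketable R" and nonneg: "\<And>r. r \<in> R \<Longrightarrow> 0 \<le> r"
  shows "four_values_condition R"
proof -
  have "\<exists>y\<in>R. y \<leadsto> (a, d, c, b)"
    if R: "a \<in> R" "b \<in> R" "c \<in> R" "d \<in> R" "x \<in> R"
      and le: "b \<le> a" "c \<le> a" "d \<le> a" and x: "x \<leadsto> (a, b, c, d)" for a b c d x
  proof -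
    have ge0: "0 \<le> a" "0 \<le> b" "0 \<le> c" "0 \<le> d"
      using R nonneg by auto
    have "a \<le> x + b" "x \<le> c + d"
      using x by (auto simp: leads_to_def metric_triple_def)
    then obtain y where y: "y \<in> R" "a \<le> y + d" "y \<le> b + c"
      using rebracketableD[OF assms(1) R] by blast
    consider "a \<le> b + c" | "a \<le> max b c + d" | "b + c < a" "max b c + d < a"
      by linarith
    then show ?thesis
    proof cases
      case 1
      then show ?thesis
        using R le ge0 by (intro bexI[of _ a]) (auto simp: leads_to_def metric_triple_def)
    next
      case 2
      then show ?thesis
        using R le ge0
        by (intro bexI[of _ "max b c"]) (auto simp: leads_to_def metric_triple_def max_def)
    next
      \<comment> \<open>Failure of the first two cases yields the missing bounds:
        \<open>y \<le> b + c < a\<close> gives \<open>y \<le> a + d\<close>, and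
        \<open>max b c < a - d \<le> y\<close> gives \<open>b \<le> c + y\<close> and
        \<open>c \<le> b + y\<close>.\<close>
      case 3
      then show ?thesis
        using y le ge0 nonneg[OF y(1)]
        by (intro bexI[of _ y]) (auto simp: leads_to_def metric_triple_def)
    qed
  qed
  then show ?thesis
    by (auto simp: four_values_condition_def quadruples_def)
qed

section \<open>Intervals and pairs of distant copies\<close>

lemma rebracketable_Icc: "rebracketable {0..l}"
  unfolding rebracketable_def
proof (intro ballI impI)
  fix a b c d x :: real
  assume "a \<in> {0..l}" "b \<in> {0..l}" "c \<in> {0..l}" "d \<in> {0..l}" "x \<in> {0..l}"
    "a \<le> x + b" "x \<le> c + d"
  then show "\<exists>y\<in>{0..l}. a \<le> y + d \<and> y \<le> b + c"
    \<comment> \<open>If the minimum is \<open>b + c\<close>, then \<open>a \<le> y + d\<close> is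
      the sum of the two hypotheses.\<close>
    by (intro bexI[of _ "min a (b + c)"]) auto
qed

lemma rebracketable_Un_translate:
  assumes S: "rebracketable S" "S \<subseteq> {0..l}" and le: "2 * l < e"
  shows "rebracketable (S \<union> (+) e ` S)"
  unfolding rebracketable_def
proof (intro ballI impI)
  let ?R = "S \<union> (+) e ` S"
  fix a b c d x
  assume R: "a \<in> ?R" "b \<in> ?R" "c \<in> ?R" "d \<in> ?R" "x \<in> ?R"
    and a_le: "a \<le> x + b" and x_le: "x \<le> c + d"
  have small: "0 \<le> r \<and> r \<le> l" if "r \<in> S" for r
    using S(2) that by auto
  have lift: "\<exists>y\<in>?R. a \<le> y + d \<and> y \<le> b + c" if "y \<in> ?R" "a \<le> y + d" "y \<le> b + c" for y
    using that by blast
  have split: "r \<in> S \<or> (\<exists>s\<in>S. r = e + s)" if "r \<in> ?R" for r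
    using that by auto
  have "0 \<le> e"
    using small R(1) le by force
  then have bounds: "0 \<le> r \<and> r \<le> e + l" if "r \<in> ?R" for r
    using split[OF that] small by force
  \<comment> \<open>In the first three cases \<open>a\<close>, \<open>b\<close> and \<open>c\<close>
    respectively serve as \<open>y\<close>.\<close>
  consider "a \<le> b + c" | "a \<le> b + d" | "a \<le> c + d" | "b + c < a" "b + d < a" "c + d < a"
    by linarith
  then show "\<exists>y\<in>?R. a \<le> y + d \<and> y \<le> b + c"
  proof cases
    case 1
    then show ?thesis using R bounds[of d] by (intro lift[of a]) auto
  next
    case 2
    then show ?thesis using R bounds[of c] by (intro lift[of b]) auto
  next
    case 3
    then show ?thesis using R bounds[of b] by (intro lift[of c]) auto
  next
    case lt: 4
    have nonneg: "0 \<le> b" "0 \<le> c" "0 \<le> d"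
      using R bounds by auto
    have x_lt: "x < a"
      using x_le lt by linarith
    show ?thesis
    proof (cases "a \<in> S")
      case True
      have memS: "r \<in> S" if "r \<in> ?R" "r < a" for r
        using split[OF that(1)] small small[OF True] that(2) le by force
      have "b \<in> S" "c \<in> S" "d \<in> S" "x \<in> S"
        using memS[OF R(2)] memS[OF R(3)] memS[OF R(4)] memS[OF R(5)] lt nonneg x_lt
        by linarith+
      from rebracketableD[OF S(1) True this a_le x_le]
      obtain y where "y \<in> S" "a \<le> y + d" "y \<le> b + c" .
      then show ?thesis by (intro lift) auto
    next
      case False
      then obtain a' where a': "a' \<in> S" "a = e + a'"
        using split R(1) by blast
      \<comment> \<open>Two elements of the upper copy sum to at least \<open>2 * e\<close>, which
        exceeds \<open>e + l\<close> and hence \<open>a\<close>.\<close>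
      have not_both: "r \<in> S \<or> s \<in> S" if rs: "r \<in> ?R" "s \<in> ?R" "r + s < a" for r s
      proof (rule ccontr)
        assume "\<not> (r \<in> S \<or> s \<in> S)"
        then obtain r' s' where "r' \<in> S" "r = e + r'" "s' \<in> S" "s = e + s'"
          using split[OF rs(1)] split[OF rs(2)] by blast
        then show False
          using small[of r'] small[of s'] small[OF a'(1)] a'(2) rs(3) le by linarith
      qed
      have sum_lt: "r + s < e" if "r \<in> S" "s \<in> S" for r s
        using small[OF that(1)] small[OF that(2)] le by linarith
      have e_le: "e \<le> x + b"
        using a' a_le small by force
      consider (b) b' where "b' \<in> S" "b = e + b'" "c \<in> S" "d \<in> S"
        | (c) c' where "c' \<in> S" "c = e + c'" "b \<in> S" "d \<in> S"
        | (d) d' where "d' \<in> S" "d = e + d'" "b \<in> S" "c \<in> S"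
        | (none) "b \<in> S" "c \<in> S" "d \<in> S"
        using split[OF R(2)] split[OF R(3)] split[OF R(4)]
          not_both[OF R(2,3) lt(1)] not_both[OF R(2,4) lt(2)] not_both[OF R(3,4) lt(3)]
        by blast
      then show ?thesis
      proof cases
        \<comment> \<open>Here \<open>x \<le> c + d < e\<close> keeps \<open>x\<close> in the lower
          copy, so \<open>e\<close> is subtracted from \<open>a\<close> and \<open>b\<close> only.
          The witness is shifted back by \<open>e\<close>, matching the shift in
          \<open>y \<le> b + c\<close>.\<close>
        case b
        then have "x \<in> S"
          using split[OF R(5)] small sum_lt[of c d] x_le by force
        moreover have "a' \<le> x + b'"
          using a_le a' b by simp
        ultimately obtain y where "y \<in> S" "a' \<le> y + d" "y \<le> b' + c"
          using rebracketableD[OF S(1) a'(1) b(1,3,4) _ _ x_le] by blast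
        then show ?thesis
          using a' b by (intro lift[of "e + y"]) auto
      next
        \<comment> \<open>Now \<open>x\<close> must lie in the upper copy, since otherwise
          \<open>x + b < e\<close>. Thus \<open>a\<close>, \<open>c\<close> and \<open>x\<close> are
          all shifted, and so is the witness.\<close>
        case c
        then obtain x' where x': "x' \<in> S" "x = e + x'"
          using split[OF R(5)] sum_lt[of x b] e_le by force
        have "a' \<le> x' + b" "x' \<le> c' + d"
          using a_le x_le a' c x' by auto
        from rebracketableD[OF S(1) a'(1) c(3,1,4) x'(1) this]
        obtain y where "y \<in> S" "a' \<le> y + d" "y \<le> b + c'" .
        then show ?thesis
          using a' c by (intro lift[of "e + y"]) auto
      next
        \<comment> \<open>Again \<open>x\<close> is in the upper copy, but the shifts of
          \<open>a\<close> and \<open>d\<close> cancel in \<open>a \<le> y + d\<close>, so the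
          witness stays in \<open>S\<close>.\<close>
        case d
        then obtain x' where x': "x' \<in> S" "x = e + x'"
          using split[OF R(5)] sum_lt[of x b] e_le by force
        have "a' \<le> x' + b" "x' \<le> c + d'"
          using a_le x_le a' d x' by auto
        from rebracketableD[OF S(1) a'(1) d(3,4,1) x'(1) this]
        obtain y where "y \<in> S" "a' \<le> y + d'" "y \<le> b + c" .
        then show ?thesis
          using a' d by (intro lift[of y]) auto
      next
        case none
        then have "x \<in> S"
          using split[OF R(5)] small sum_lt[of c d] x_le by force
        then show ?thesis
          using sum_lt[of x b] none e_le by simp
      qed
    qed
  qed
qed

section \<open>Structure of the finite stages\<close>

lemma cantor_fin_translate: "cantor_fin (t + a) ws (t + b) = (+) t ` cantor_fin a ws b"
proof (induction ws arbitrary: a b)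
  case Nil
  show ?case by simp
next
  case (Cons w ws)
  have "gap_left (t + a) w (t + b) = t + gap_left a w b"
    "gap_right (t + a) w (t + b) = t + gap_right a w b"
    by (simp_all add: gap_left_def gap_right_def field_simps)
  then show ?case
    using Cons by (simp add: image_Un)
qed

lemma gap_bounds:
  assumes "a \<le> b" "0 \<le> w" "w \<le> 1"
  shows "a \<le> gap_left a w b" "gap_left a w b \<le> b" "a \<le> gap_right a w b" "gap_right a w b \<le> b"
proof -
  have "gap_left a w b - a = (1 - w) * (b - a) / 2" "b - gap_left a w b = (1 + w) * (b - a) / 2"
    "gap_right a w b - a = (1 + w) * (b - a) / 2" "b - gap_right a w b = (1 - w) * (b - a) / 2"
    by (simp_all add: gap_left_def gap_right_def field_simps)
  moreover have "0 \<le> (1 - w) * (b - a) / 2" "0 \<le> (1 + w) * (b - a) / 2"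
    using assms by simp_all
  ultimately show "a \<le> gap_left a w b" "gap_left a w b \<le> b"
    "a \<le> gap_right a w b" "gap_right a w b \<le> b"
    by linarith+
qed

text \<open>Appended weights only remove further gaps at deeper levels. With \<open>us = []\<close>
  this bounds a stage by its interval; in general it makes the stages of an infinite sequence
  decrease.\<close>

lemma cantor_fin_append_subset:
  assumes "a \<le> b" "\<forall>w\<in>set (us @ vs). 0 \<le> w \<and> w \<le> 1"
  shows "cantor_fin a (us @ vs) b \<subseteq> cantor_fin a us b"
  using assms
proof (induction us arbitrary: a b)
  case Nil
  then show ?case
  proof (induction vs arbitrary: a b)
    case Nil
    then show ?case by simp
  next
    case (Cons v vs)
    then have g: "a \<le> gap_left a v b" "gap_left a v b \<le> b"
      "a \<le> gap_right a v b" "gap_right a v b \<le> b"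
      using gap_bounds[of a b v] by auto
    have "cantor_fin a vs (gap_left a v b) \<subseteq> {a..gap_left a v b}"
      "cantor_fin (gap_right a v b) vs b \<subseteq> {gap_right a v b..b}"
      using Cons.IH[OF g(1)] Cons.IH[OF g(4)] Cons.prems by auto
    then show ?case
      using g by fastforce
  qed
next
  case (Cons u us)
  then have "a \<le> gap_left a u b" "gap_right a u b \<le> b"
    using gap_bounds[of a b u] by auto
  then show ?case
    using Cons.IH[of a "gap_left a u b"] Cons.IH[of "gap_right a u b" b] Cons.prems by auto
qed

lemma cantor_fin_subset_Icc:
  assumes "a \<le> b" "\<forall>w\<in>set ws. 0 \<le> w \<and> w \<le> 1"
  shows "cantor_fin a ws b \<subseteq> {a..b}"
  using cantor_fin_append_subset[of a b "[]" ws] assms by simp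

lemma closed_cantor_fin: "closed (cantor_fin a ws b)"
  by (induction ws arbitrary: a b) (auto intro: closed_Un)

lemma rebracketable_cantor_fin:
  assumes "0 \<le> l" "\<forall>w\<in>set ws. 1/3 < w \<and> w \<le> 1"
  shows "rebracketable (cantor_fin 0 ws l)"
  using assms
proof (induction ws arbitrary: l)
  case Nil
  show ?case by (simp add: rebracketable_Icc)
next
  case (Cons w ws)
  let ?S = "cantor_fin 0 ws (gap_left 0 w l)"
  have w: "1/3 < w" "w \<le> 1"
    using Cons.prems by auto
  \<comment> \<open>The two outer intervals have equal length, so the right half is the left half
    moved by \<open>gap_right 0 w l\<close>.\<close>
  have union: "cantor_fin 0 (w # ws) l = ?S \<union> (+) (gap_right 0 w l) ` ?S"
  proof -
    have "gap_right 0 w l + gap_left 0 w l = l"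
      by (simp add: gap_left_def gap_right_def field_simps)
    then show ?thesis
      using cantor_fin_translate[of "gap_right 0 w l" 0 ws "gap_left 0 w l"] by simp
  qed
  show ?case
  proof (cases "l = 0")
    case True
    then have "gap_left 0 w l = 0" "gap_right 0 w l = 0"
      by (simp_all add: gap_left_def gap_right_def)
    then show ?thesis
      using Cons.IH[of 0] Cons.prems union by simp
  next
    case False
    have g: "0 \<le> gap_left 0 w l"
      using gap_bounds[of 0 l w] Cons.prems by auto
    \<comment> \<open>The threshold \<open>1/3\<close> enters here: for \<open>l > 0\<close> the
      difference is positive exactly when \<open>w > 1/3\<close>.\<close>
    have "gap_right 0 w l - 2 * gap_left 0 w l = (3 * w - 1) * l / 2"
      by (simp add: gap_left_def gap_right_def field_simps)
    moreover have "0 < (3 * w - 1) * l / 2"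
      using False Cons.prems w by simp
    ultimately have "2 * gap_left 0 w l < gap_right 0 w l"
      by linarith
    moreover have "?S \<subseteq> {0..gap_left 0 w l}"
      using g Cons.prems by (intro cantor_fin_subset_Icc) force+
    ultimately show ?thesis
      unfolding union using Cons.IH[OF g] Cons.prems by (intro rebracketable_Un_translate) auto
  qed
qed

section \<open>Passage to infinite sequences\<close>

text \<open>The admissible \<open>y\<close> fill the compact interval \<open>{a - d..b + c}\<close>,
  the same at every stage. A witness at a late stage lies in all earlier ones, so the finite
  intersection property gives a common witness.\<close>

lemma rebracketable_Inter_decseq:
  assumes R: "\<And>n. rebracketable (R n)" and closed: "\<And>n. closed (R n)" and dec: "decseq R"
  shows "rebracketable (\<Inter>n. R n)"
  unfolding rebracketable_def
proof (intro ballI impI)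
  fix a b c d x
  assume mem: "a \<in> (\<Inter>n. R n)" "b \<in> (\<Inter>n. R n)" "c \<in> (\<Inter>n. R n)" "d \<in> (\<Inter>n. R n)"
      "x \<in> (\<Inter>n. R n)"
    and le: "a \<le> x + b" "x \<le> c + d"
  have "{a - d..b + c} \<inter> (\<Inter>n\<in>UNIV. R n) \<noteq> {}"
  proof (rule compact_imp_fip_image)
    fix I :: "nat set"
    assume "finite I"
    then obtain m where m: "\<And>n. n \<in> I \<Longrightarrow> n \<le> m"
      by (meson finite_nat_set_iff_bounded_le)
    have "a \<in> R m" "b \<in> R m" "c \<in> R m" "d \<in> R m" "x \<in> R m"
      using mem by auto
    from rebracketableD[OF R this le]
    obtain y where y: "y \<in> R m" "a \<le> y + d" "y \<le> b + c" .
    then have "y \<in> {a - d..b + c} \<inter> (\<Inter>n\<in>I. R n)"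
      using decseqD[OF dec] m by auto
    then show "{a - d..b + c} \<inter> (\<Inter>n\<in>I. R n) \<noteq> {}"
      by blast
  qed (auto simp: closed)
  then show "\<exists>y\<in>\<Inter>n. R n. a \<le> y + d \<and> y \<le> b + c"
    by force
qed

lemma decseq_cantor_fin:
  assumes "a \<le> b" "\<And>i. 0 \<le> w i \<and> w i \<le> 1"
  shows "decseq (\<lambda>n. cantor_fin a (map w [0..<n]) b)"
  \<comment> \<open>The list for \<open>Suc n\<close> is the list for \<open>n\<close> with
    \<open>w n\<close> appended.\<close>
  unfolding decseq_Suc_iff
  using cantor_fin_append_subset[OF assms(1)] assms(2) by auto

theorem theorem10p1:
  shows "(\<forall>ws :: real list. (\<forall>i < length ws. 1/3 < ws ! i \<and> ws ! i < 1) \<longrightarrow>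
            four_values_condition (cantor_fin 0 ws 1)) \<and>
         (\<forall>w :: nat \<Rightarrow> real. (\<forall>i. 1/3 < w i \<and> w i < 1) \<longrightarrow>
            four_values_condition (cantor_inf 0 w 1))"
proof (intro conjI allI impI)
  fix ws :: "real list"
  assume "\<forall>i < length ws. 1/3 < ws ! i \<and> ws ! i < 1"
  then have ws: "1/3 < w \<and> w < 1" if "w \<in> set ws" for w
    using that by (metis in_set_conv_nth)
  then have "rebracketable (cantor_fin 0 ws 1)"
    by (intro rebracketable_cantor_fin) force+
  moreover have "cantor_fin 0 ws 1 \<subseteq> {0..1}"
    using ws by (intro cantor_fin_subset_Icc) force+
  ultimately show "four_values_condition (cantor_fin 0 ws 1)"
    by (intro rebracketable_imp_four_values_condition) auto
next
  fix w :: "nat \<Rightarrow> real"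
  assume w: "\<forall>i. 1/3 < w i \<and> w i < 1"
  then have bounds: "1/3 < w i" "0 \<le> w i" "w i \<le> 1" for i
    by (force simp: less_imp_le intro: order_trans[of 0 "1/3"])+
  have "rebracketable (cantor_inf 0 w 1)"
    unfolding cantor_inf_def using bounds
    by (intro rebracketable_Inter_decseq rebracketable_cantor_fin closed_cantor_fin
        decseq_cantor_fin) auto
  moreover have "cantor_inf 0 w 1 \<subseteq> {0..1}"
    \<comment> \<open>Stage \<open>0\<close> has the empty list and equals
      \<open>{0..1}\<close>.\<close>
    unfolding cantor_inf_def by (intro INF_lower2[of 0]) auto
  ultimately show "four_values_condition (cantor_inf 0 w 1)"
    by (intro rebracketable_imp_four_values_condition) auto
qed

end
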